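(* Fix a number $n$ of players and numbers of actions $m_1,\dots,m_n\ge 1$. In the space of all $n$-player finite strategic-form games in which player $i$ has $m_i$ actions, identified with $\mathbb{R}^{n m_1m_2\cdots m_n}$ via the utility tensors $(U_1,\dots,U_n)$, the set of games having a $2$-strong Nash equilibrium in which at least one player plays a mixed (i.e. non-pure) strategy has zero (Lebesgue) measure.
   Context: In an $n$-player finite strategic-form game, player $i\in N=\{1,\dots,n\}$ has a set $A_i$ of $m_i$ actions and a utility function $U_i:A_1\times\dots\times A_n\to\mathbb{R}$. A mixed strategy of player $i$ is a vector $x_i$ in the simplex $\Delta_i$ of probability distributions on $A_i$; it is non-pure if it gives positive probability to at least two actions. At a profile $x=(x_1,\dots,x_n)$ (players randomizing independently) the utility of player $i$ is the expected utility $v_i(x)=\sum_{i_1,\dots,i_n}U_i(i_1,\dots,i_n)\,x_{1i_1}\cdots x_{ni_n}$. A profile $\bar x$ is a Nash equilibrium if $v_i(\bar x)\ge v_i(x_i,\bar x_{-i})$ for each $i$ and each $x_i\in\Delta_i$. For a coalition $C$ (a nonempty subset of $N$), a profile $\bar x$ is weakly Pareto efficient for $C$ if there is no profile $y$, with $y_i=\bar x_i$ for all $i\notin C$ and $y_i\in\Delta_i$ arbitrary for $i\in C$, such that $v_i(y)>v_i(\bar x)$ for all $i\in C$. A $k$-strong Nash equilibrium is a Nash equilibrium that is weakly Pareto efficient for every coalition of $k$ or fewer players. *)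

theory Defs
  imports "HOL-Analysis.Analysis"
begin

(* Players are 1..n; player i has the actions 1..m i. *)

definition players :: "nat \<Rightarrow> nat set" where
  "players n = {1..n}"

definition actions :: "(nat \<Rightarrow> nat) \<Rightarrow> nat \<Rightarrow> nat set" where
  "actions m i = {1..m i}"

definition action_profiles :: "nat \<Rightarrow> (nat \<Rightarrow> nat) \<Rightarrow> (nat \<Rightarrow> nat) set" where
  "action_profiles n m = (\<Pi>\<^sub>E i\<in>players n. actions m i)"

(* A game is the family of all utilities: U (i, a) is the utility of player i at the
   action profile a.  As a point of game_space it is an extensional function on the
   index set players n \<times> action_profiles n m, which has n * m 1 * ... * m n elements. *)

type_synonym game = "nat \<times> (nat \<Rightarrow> nat) \<Rightarrow> real"

(* Lebesgue measure on the space of games: the completed product, over the finite index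
   set of all utility entries, of the one-dimensional Lebesgue-Borel measures. *)

definition game_space :: "nat \<Rightarrow> (nat \<Rightarrow> nat) \<Rightarrow> game measure" where
  "game_space n m = completion (\<Pi>\<^sub>M ia\<in>players n \<times> action_profiles n m. lborel)"

definition mixed_strategies :: "(nat \<Rightarrow> nat) \<Rightarrow> nat \<Rightarrow> (nat \<Rightarrow> real) set" where
  "mixed_strategies m i =
     {p \<in> actions m i \<rightarrow>\<^sub>E {0..}. (\<Sum>j\<in>actions m i. p j) = 1}"

definition non_pure :: "(nat \<Rightarrow> nat) \<Rightarrow> nat \<Rightarrow> (nat \<Rightarrow> real) \<Rightarrow> bool" where
  "non_pure m i p \<longleftrightarrow> card {j \<in> actions m i. p j > 0} \<ge> 2"

definition mixed_profiles :: "nat \<Rightarrow> (nat \<Rightarrow> nat) \<Rightarrow> (nat \<Rightarrow> nat \<Rightarrow> real) set" where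
  "mixed_profiles n m = (\<Pi>\<^sub>E i\<in>players n. mixed_strategies m i)"

definition expected_utility ::
    "nat \<Rightarrow> (nat \<Rightarrow> nat) \<Rightarrow> game \<Rightarrow> nat \<Rightarrow> (nat \<Rightarrow> nat \<Rightarrow> real) \<Rightarrow> real" where
  "expected_utility n m U i x =
     (\<Sum>a\<in>action_profiles n m. U (i, a) * (\<Prod>k\<in>players n. x k (a k)))"

definition nash_equilibrium ::
    "nat \<Rightarrow> (nat \<Rightarrow> nat) \<Rightarrow> game \<Rightarrow> (nat \<Rightarrow> nat \<Rightarrow> real) \<Rightarrow> bool" where
  "nash_equilibrium n m U x \<longleftrightarrow>
     x \<in> mixed_profiles n m \<and>
     (\<forall>i\<in>players n. \<forall>p\<in>mixed_strategies m i.
        expected_utility n m U i x \<ge> expected_utility n m U i (x(i := p)))"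

definition weakly_pareto_efficient ::
    "nat \<Rightarrow> (nat \<Rightarrow> nat) \<Rightarrow> game \<Rightarrow> nat set \<Rightarrow> (nat \<Rightarrow> nat \<Rightarrow> real) \<Rightarrow> bool" where
  "weakly_pareto_efficient n m U C x \<longleftrightarrow>
     \<not> (\<exists>y\<in>mixed_profiles n m.
          (\<forall>i\<in>players n - C. y i = x i) \<and>
          (\<forall>i\<in>C. expected_utility n m U i y > expected_utility n m U i x))"

definition strong_nash_equilibrium ::
    "nat \<Rightarrow> nat \<Rightarrow> (nat \<Rightarrow> nat) \<Rightarrow> game \<Rightarrow> (nat \<Rightarrow> nat \<Rightarrow> real) \<Rightarrow> bool" where
  "strong_nash_equilibrium k n m U x \<longleftrightarrow>
     nash_equilibrium n m U x \<and>
     (\<forall>C. C \<noteq> {} \<and> C \<subseteq> players n \<and> card C \<le> k \<longrightarrow> weakly_pareto_efficient n m U C x)"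

end

(* In a 2-strong equilibrium, let the players i and k both mix. If some action in the support of k
   changed the utility of i, and some action in the support of i that of k, then suitable small
   simultaneous shifts would help both: by indifference, a player's own shift does not affect his
   utility to first order. So one of them, say i, is also indifferent between the actions in the
   support of k. Together with the usual indifference conditions these are more equations, linear
   in the utilities, than there are free probabilities. Covering the strategies by a grid of mesh
   1/N replaces the set of games by the union of O(N^D) intersections of at least D + 1 slabs of
   width O(1/N), of total volume O(1/N). If only one player mixes, the utilities of two pure
   profiles coincide. *)
theory Submission
  imports Defs
begin

section \<open>Unions of solution sets of linear systems\<close>

text \<open>Each equation is named by a coordinate \<open>p\<close>, its pivot, so that
  \<open>c p\<close> is its row of coefficients and \<open>c p p\<close> its pivot entry. The cube
  bounded by \<open>R\<close> keeps volumes finite.\<close>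

definition slabs :: "'i set \<Rightarrow> real \<Rightarrow> ('i \<Rightarrow> 'i \<Rightarrow> real) \<Rightarrow> 'i list \<Rightarrow> real \<Rightarrow> ('i \<Rightarrow> real) set" where
  "slabs I R c ps \<epsilon> =
     {U \<in> I \<rightarrow>\<^sub>E {-R..R}. \<forall>p\<in>set ps. \<bar>\<Sum>i\<in>I. c p i * U i\<bar> \<le> \<epsilon>}"

lemma sets_slabs:
  assumes "finite I"
  shows "slabs I R c ps \<epsilon> \<in> sets (\<Pi>\<^sub>M i\<in>I. lborel)"
proof -
  have eq: "slabs I R c ps \<epsilon> =
      {U \<in> space (\<Pi>\<^sub>M i\<in>I. lborel). (\<forall>i\<in>I. -R \<le> U i \<and> U i \<le> R) \<and> (\<forall>p\<in>set ps. \<bar>\<Sum>i\<in>I. c p i * U i\<bar> \<le> \<epsilon>)}"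
    by (auto simp: slabs_def space_PiM PiE_iff)
  show ?thesis
    unfolding eq using assms countable_finite[OF assms] by measurable
qed

lemma emeasure_slab_le:
  fixes c s \<epsilon> \<delta> :: real
  assumes "\<delta> > 0" "\<delta> \<le> c" "\<epsilon> \<ge> 0"
  shows "emeasure lborel {t. \<bar>c * t + s\<bar> \<le> \<epsilon>} \<le> ennreal (2 * \<epsilon> / \<delta>)"
proof -
  have "{t. \<bar>c * t + s\<bar> \<le> \<epsilon>} = {(- \<epsilon> - s) / c .. (\<epsilon> - s) / c}"
    using assms by (auto simp: field_simps abs_le_iff)
  also have "emeasure lborel \<dots> = ennreal ((\<epsilon> - s) / c - (- \<epsilon> - s) / c)"
    using assms by (subst emeasure_lborel_Icc) (auto simp: divide_right_mono)
  also have "(\<epsilon> - s) / c - (- \<epsilon> - s) / c = 2 * \<epsilon> / c"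
    by (simp add: diff_divide_distrib [symmetric])
  also have "\<dots> \<le> 2 * \<epsilon> / \<delta>"
    using assms by (intro divide_left_mono) auto
  finally show ?thesis
    by (simp add: ennreal_leI)
qed

text \<open>Fubini along the pivots. The system is triangular: the pivot of an equation is absent
  from all later ones in \<open>ps\<close>. Integrating over the pivot of the first equation
  therefore meets only that equation, which confines it to an interval of length at most
  \<open>2 * \<epsilon> / \<delta>\<close>; each coordinate that is no pivot contributes the side
  \<open>2 * R\<close> of the cube.\<close>

lemma emeasure_slabs_le:
  fixes c :: "'i \<Rightarrow> 'i \<Rightarrow> real"
  assumes "finite I" "distinct ps" "set ps \<subseteq> I" "sorted_wrt (\<lambda>p q. c q p = 0) ps"
    and "\<And>p. p \<in> set ps \<Longrightarrow> \<delta> \<le> c p p"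
    and "\<delta> > 0" "\<epsilon> \<ge> 0" "R \<ge> 0"
  shows "emeasure (\<Pi>\<^sub>M i\<in>I. lborel) (slabs I R c ps \<epsilon>)
    \<le> ennreal ((2 * R) ^ (card I - length ps) * (2 * \<epsilon> / \<delta>) ^ length ps)"
  using assms(1-5)
proof (induction ps arbitrary: I)
  case Nil
  interpret product_sigma_finite "\<lambda>_::'i. lborel :: real measure"
    by standard
  have "slabs I R c [] \<epsilon> = (I \<rightarrow>\<^sub>E {-R..R})"
    by (simp add: slabs_def)
  then show ?case
    using Nil \<open>R \<ge> 0\<close> by (simp add: emeasure_PiM ennreal_power)
next
  case (Cons p ps)
  interpret product_sigma_finite "\<lambda>_::'i. lborel :: real measure"
    by standard
  define J where "J = I - {p}"
  have J: "finite J" "p \<notin> J" "I = insert p J" "set ps \<subseteq> J"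
    using Cons.prems by (auto simp: J_def)
  have zero: "c q p = 0" if "q \<in> set ps" for q
    using Cons.prems(4) that by auto
  have sum_upd: "(\<Sum>i\<in>I. c q i * (U(p := t)) i) = c q p * t + (\<Sum>i\<in>J. c q i * U i)" for q U t
    unfolding J(3) using J(1,2) by (simp add: sum.insert) (intro sum.cong, auto)
  \<comment> \<open>Only the second factor depends on \<open>t\<close>, so the inner integral
    becomes the length of one slab.\<close>
  have slice: "indicator (slabs I R c (p # ps) \<epsilon>) (U(p := t))
      \<le> (indicator (slabs J R c ps \<epsilon>) U * indicator {t. \<bar>c p p * t + (\<Sum>i\<in>J. c p i * U i)\<bar> \<le> \<epsilon>} t :: ennreal)"
    if "U \<in> space (\<Pi>\<^sub>M i\<in>J. lborel)" for U t
  proof (cases "U(p := t) \<in> slabs I R c (p # ps) \<epsilon>")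
    case True
    then have U: "U(p := t) \<in> I \<rightarrow>\<^sub>E {-R..R}"
      and le: "\<And>q. q \<in> insert p (set ps) \<Longrightarrow> \<bar>c q p * t + (\<Sum>i\<in>J. c q i * U i)\<bar> \<le> \<epsilon>"
      by (auto simp: slabs_def sum_upd simp del: fun_upd_apply)
    have "U \<in> J \<rightarrow>\<^sub>E {-R..R}"
    proof (rule PiE_I)
      fix i assume "i \<in> J"
      then show "U i \<in> {-R..R}"
        using PiE_mem[OF U, of i] J by (auto split: if_splits)
    next
      fix i assume "i \<notin> J"
      then show "U i = undefined"
        using that by (auto simp: space_PiM PiE_iff extensional_def)
    qed
    moreover have "\<bar>\<Sum>i\<in>J. c q i * U i\<bar> \<le> \<epsilon>" if "q \<in> set ps" for q
      using le[of q] zero[OF that] that by simp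
    ultimately have "U \<in> slabs J R c ps \<epsilon>"
      by (simp add: slabs_def)
    then show ?thesis
      using le[of p] by (simp add: indicator_def)
  qed simp
  have "emeasure (\<Pi>\<^sub>M i\<in>I. lborel) (slabs I R c (p # ps) \<epsilon>)
      = (\<integral>\<^sup>+ U. indicator (slabs I R c (p # ps) \<epsilon>) U \<partial>(\<Pi>\<^sub>M i\<in>I. lborel))"
    using Cons.prems(1) by (simp add: sets_slabs)
  also have "\<dots> = (\<integral>\<^sup>+ U. (\<integral>\<^sup>+ t. indicator (slabs I R c (p # ps) \<epsilon>) (U(p := t)) \<partial>lborel) \<partial>(\<Pi>\<^sub>M i\<in>J. lborel))"
    unfolding J(3) using J(1,2)
    by (intro product_nn_integral_insert borel_measurable_indicator sets_slabs) auto
  also have "\<dots> \<le> (\<integral>\<^sup>+ U. indicator (slabs J R c ps \<epsilon>) U * ennreal (2 * \<epsilon> / \<delta>) \<partial>(\<Pi>\<^sub>M i\<in>J. lborel))"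
  proof (rule nn_integral_mono)
    fix U assume U: "U \<in> space (\<Pi>\<^sub>M i\<in>J. lborel :: real measure)"
    have "(\<integral>\<^sup>+ t. indicator (slabs I R c (p # ps) \<epsilon>) (U(p := t)) \<partial>lborel)
        \<le> (\<integral>\<^sup>+ t. indicator (slabs J R c ps \<epsilon>) U *
              indicator {t. \<bar>c p p * t + (\<Sum>i\<in>J. c p i * U i)\<bar> \<le> \<epsilon>} t \<partial>lborel)"
      using slice[OF U] by (intro nn_integral_mono)
    also have "\<dots> = indicator (slabs J R c ps \<epsilon>) U *
        emeasure lborel {t. \<bar>c p p * t + (\<Sum>i\<in>J. c p i * U i)\<bar> \<le> \<epsilon>}"
      by (subst nn_integral_cmult) auto
    also have "\<dots> \<le> indicator (slabs J R c ps \<epsilon>) U * ennreal (2 * \<epsilon> / \<delta>)"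
      using Cons.prems(5)[of p] assms(6,7) by (intro mult_left_mono emeasure_slab_le) auto
    finally show "(\<integral>\<^sup>+ t. indicator (slabs I R c (p # ps) \<epsilon>) (U(p := t)) \<partial>lborel)
        \<le> indicator (slabs J R c ps \<epsilon>) U * ennreal (2 * \<epsilon> / \<delta>)" .
  qed
  also have "\<dots> = emeasure (\<Pi>\<^sub>M i\<in>J. lborel) (slabs J R c ps \<epsilon>) * ennreal (2 * \<epsilon> / \<delta>)"
    using J(1) by (subst nn_integral_multc) (auto intro!: borel_measurable_indicator sets_slabs simp: sets_slabs)
  also have "\<dots> \<le> ennreal ((2 * R) ^ (card J - length ps) * (2 * \<epsilon> / \<delta>) ^ length ps) * ennreal (2 * \<epsilon> / \<delta>)"
    using Cons.prems J by (intro mult_right_mono Cons.IH) auto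
  also have "\<dots> = ennreal ((2 * R) ^ (card I - length (p # ps)) * (2 * \<epsilon> / \<delta>) ^ length (p # ps))"
    using assms(6-8) J by (simp add: ennreal_mult' [symmetric] mult_ac)
  finally show ?case .
qed

text \<open>The solution set of each system has codimension \<open>length ps\<close>, while the parameter only
  ranges over a set of box dimension at most \<open>D < length ps\<close>.\<close>

lemma null_sets_union_solutions:
  fixes c :: "'x \<Rightarrow> 'i \<Rightarrow> 'i \<Rightarrow> real"
  assumes "finite I" "distinct ps" "set ps \<subseteq> I"
    and tri: "\<And>x. x \<in> X \<Longrightarrow> sorted_wrt (\<lambda>p q. c x q p = 0) ps"
    and diag: "\<And>x p. x \<in> X \<Longrightarrow> p \<in> set ps \<Longrightarrow> \<delta> \<le> c x p p"
    and "\<delta> > 0" "L \<ge> 0"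
    and D: "D < length ps"
    and net: "\<And>N::nat. \<exists>Y\<subseteq>X. finite Y \<and> real (card Y) \<le> K * real (Suc N) ^ D \<and>
      (\<forall>x\<in>X. \<exists>y\<in>Y. \<forall>p\<in>set ps. \<forall>i\<in>I. \<bar>c x p i - c y p i\<bar> \<le> L / real (Suc N))"
  shows "{U \<in> I \<rightarrow>\<^sub>E UNIV. \<exists>x\<in>X. \<forall>p\<in>set ps. (\<Sum>i\<in>I. c x p i * U i) = 0}
    \<in> null_sets (completion (\<Pi>\<^sub>M i\<in>I. lborel))" (is "?Z \<in> _")
proof -
  let ?M = "(\<Pi>\<^sub>M i\<in>I. lborel) :: ('i \<Rightarrow> real) measure"
  \<comment> \<open>A change of the coefficients moves the value of an equation in proportion to the
    size of \<open>U\<close>; hence \<open>U\<close> is first bounded by \<open>R\<close>.\<close>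
  define Z where "Z R = ?Z \<inter> (I \<rightarrow>\<^sub>E {-R..R})" for R
  obtain Y where Y: "\<And>N::nat. Y N \<subseteq> X" "\<And>N. finite (Y N)"
    "\<And>N. real (card (Y N)) \<le> K * real (Suc N) ^ D"
    and Y_near: "\<And>N x. x \<in> X \<Longrightarrow> \<exists>y\<in>Y N. \<forall>p\<in>set ps. \<forall>i\<in>I. \<bar>c x p i - c y p i\<bar> \<le> L / real (Suc N)"
    using net by metis
  have null: "Z (real R) \<in> null_sets (completion ?M)" for R :: nat
  proof -
    \<comment> \<open>An exact solution for \<open>x\<close> misses the equations of a nearby
      \<open>y\<close> by at most \<open>card I\<close> coefficient errors
      \<open>L / real (Suc N)\<close>, each multiplied by a coordinate of size at most
      \<open>R\<close>.\<close>
    define C where "C = real (card I) * L * real R"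
    define W where "W N = (\<Union>y\<in>Y N. slabs I (real R) (c y) ps (C / real (Suc N)))" for N
    \<comment> \<open>At width \<open>C / real (Suc N)\<close>, the number of parameters in the net
      times the volume of one system is at most
      \<open>B * real (Suc N) ^ D / real (Suc N) ^ length ps\<close>, hence at most
      \<open>B / real (Suc N)\<close> as \<open>D < length ps\<close>.\<close>
    define B where "B = K * (2 * real R) ^ (card I - length ps) * (2 * C / \<delta>) ^ length ps"
    have C: "C \<ge> 0"
      using assms by (simp add: C_def)
    have "real (card (Y 0)) \<le> K"
      using Y(3)[of 0] by simp
    then have K: "K \<ge> 0"
      using of_nat_0_le_iff order_trans by blast
    have sub: "Z (real R) \<subseteq> W N" for N
    proof
      fix U assume "U \<in> Z (real R)"
      then obtain x where x: "x \<in> X" "\<And>p. p \<in> set ps \<Longrightarrow> (\<Sum>i\<in>I. c x p i * U i) = 0"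
        and U: "U \<in> I \<rightarrow>\<^sub>E {-real R..real R}"
        by (auto simp: Z_def)
      obtain y where y: "y \<in> Y N" "\<And>p i. p \<in> set ps \<Longrightarrow> i \<in> I \<Longrightarrow> \<bar>c x p i - c y p i\<bar> \<le> L / real (Suc N)"
        using Y_near[OF x(1)] by meson
      have "\<bar>\<Sum>i\<in>I. c y p i * U i\<bar> \<le> C / real (Suc N)" if p: "p \<in> set ps" for p
      proof -
        have "(\<Sum>i\<in>I. c y p i * U i) = (\<Sum>i\<in>I. (c y p i - c x p i) * U i)"
          using x(2)[OF p] by (simp add: left_diff_distrib sum_subtractf)
        also have "\<bar>\<dots>\<bar> \<le> (\<Sum>i\<in>I. L / real (Suc N) * real R)"
        proof (rule order_trans[OF sum_abs], rule sum_mono)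
          fix i assume i: "i \<in> I"
          show "\<bar>(c y p i - c x p i) * U i\<bar> \<le> L / real (Suc N) * real R"
            unfolding abs_mult using y(2)[OF p i] PiE_mem[OF U i] \<open>L \<ge> 0\<close>
            by (intro mult_mono) auto
        qed
        also have "\<dots> = C / real (Suc N)"
          by (simp add: C_def)
        finally show ?thesis .
      qed
      then show "U \<in> W N"
        using y(1) U by (auto simp: W_def slabs_def)
    qed
    have sets_W: "W N \<in> sets ?M" for N
      unfolding W_def using Y(2) assms(1) by (intro sets.finite_UN sets_slabs) auto
    have W_le: "emeasure ?M (W N) \<le> ennreal (B / real (Suc N))" for N
    proof -
      let ?b = "(2 * real R) ^ (card I - length ps) * (2 * (C / real (Suc N)) / \<delta>) ^ length ps"
      have b: "?b \<ge> 0"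
        using C assms by auto
      have "emeasure ?M (W N) \<le> (\<Sum>y\<in>Y N. emeasure ?M (slabs I (real R) (c y) ps (C / real (Suc N))))"
        unfolding W_def using Y(2) assms(1) by (intro emeasure_subadditive_finite) (auto simp: sets_slabs)
      also have "\<dots> \<le> (\<Sum>y\<in>Y N. ennreal ?b)"
        using Y(1)[of N] assms C by (intro sum_mono emeasure_slabs_le) auto
      also have "\<dots> = ennreal (real (card (Y N)) * ?b)"
        using b by (simp add: ennreal_mult ennreal_of_nat_eq_real_of_nat)
      also have "\<dots> \<le> ennreal (B / real (Suc N))"
      proof (rule ennreal_leI)
        have "real (card (Y N)) * ?b \<le> (K * real (Suc N) ^ D) * ?b"
          using Y(3) b by (rule mult_right_mono)
        also have "\<dots> = B * (real (Suc N) ^ D / real (Suc N) ^ length ps)"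
        proof -
          have eq: "2 * (C / real (Suc N)) / \<delta> = (2 * C / \<delta>) / real (Suc N)"
            by (simp only: divide_divide_eq_left times_divide_eq_right mult.commute)
          have "(2 * (C / real (Suc N)) / \<delta>) ^ length ps
              = (2 * C / \<delta>) ^ length ps / real (Suc N) ^ length ps"
            unfolding eq by (rule power_divide)
          then show ?thesis
            by (simp only: B_def times_divide_eq_left times_divide_eq_right mult_ac)
        qed
        also have "\<dots> \<le> B * (1 / real (Suc N))"
        proof (rule mult_left_mono)
          have "real (Suc N) ^ Suc D \<le> real (Suc N) ^ length ps"
            using D by (intro power_increasing) auto
          then show "real (Suc N) ^ D / real (Suc N) ^ length ps \<le> 1 / real (Suc N)"
            by (simp add: field_simps)
          show "0 \<le> B"
            using C K assms by (auto simp: B_def)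
        qed
        finally show "real (card (Y N)) * ?b \<le> B / real (Suc N)"
          by simp
      qed
      finally show ?thesis .
    qed
    \<comment> \<open>Measurability of \<open>Z (real R)\<close> is not claimed: it lies in the
      measurable null set \<open>\<Inter>N. W N\<close>, which suffices in the completion.\<close>
    have "emeasure ?M (\<Inter>N. W N) \<le> ennreal (B / real (Suc N))" for N
      using sets_W by (intro order_trans[OF emeasure_mono W_le]) auto
    moreover have "(\<lambda>N. ennreal (B / real (Suc N))) \<longlonglongrightarrow> ennreal 0"
      by (intro tendsto_ennrealI LIMSEQ_Suc lim_const_over_n)
    ultimately have "emeasure ?M (\<Inter>N. W N) \<le> 0"
      using LIMSEQ_le_const[of _ "0::ennreal"] by auto
    then have "(\<Inter>N. W N) \<in> null_sets ?M"
      using sets_W by (intro null_setsI) auto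
    then show ?thesis
      using sub by (intro null_sets_completion_subset[OF _ null_sets_completionI]) auto
  qed
  have "?Z \<subseteq> (\<Union>R::nat. Z (real R))"
  proof
    fix U assume U: "U \<in> ?Z"
    obtain R :: nat where R: "(\<Sum>i\<in>I. \<bar>U i\<bar>) \<le> real R"
      using real_arch_simple by blast
    have "\<bar>U i\<bar> \<le> real R" if "i \<in> I" for i
      using member_le_sum[of i I "\<lambda>i. \<bar>U i\<bar>"] that R assms(1) by force
    then have "U \<in> Z (real R)"
      using U by (force simp: Z_def PiE_iff abs_le_iff)
    then show "U \<in> (\<Union>R::nat. Z (real R))"
      by blast
  qed
  moreover have "(\<Union>R::nat. Z (real R)) \<in> null_sets (completion ?M)"
    using null by (rule null_sets_UN)
  ultimately show ?thesis
    by (rule null_sets_completion_subset)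
qed

section \<open>Indifference in equilibrium\<close>

text \<open>The restriction makes the function \<open>undefined\<close> outside the actions, as
  members of \<open>mixed_strategies\<close> must be; \<open>mix\<close> is restricted for the same
  reason.\<close>

definition pure_strategy :: "(nat \<Rightarrow> nat) \<Rightarrow> nat \<Rightarrow> nat \<Rightarrow> nat \<Rightarrow> real" where
  "pure_strategy m i j = (\<lambda>j'\<in>actions m i. of_bool (j' = j))"

definition mix :: "(nat \<Rightarrow> nat) \<Rightarrow> nat \<Rightarrow> real \<Rightarrow> (nat \<Rightarrow> real) \<Rightarrow> (nat \<Rightarrow> real) \<Rightarrow> nat \<Rightarrow> real" where
  "mix m i t p q = (\<lambda>j\<in>actions m i. (1 - t) * p j + t * q j)"

definition support :: "(nat \<Rightarrow> nat) \<Rightarrow> nat \<Rightarrow> (nat \<Rightarrow> real) \<Rightarrow> nat set" where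
  "support m i p = {j \<in> actions m i. p j > 0}"

lemma finite_players [simp]: "finite (players n)"
  by (simp add: players_def)

lemma finite_actions [simp]: "finite (actions m i)"
  by (simp add: actions_def)

lemma finite_action_profiles [simp]: "finite (action_profiles n m)"
  by (simp add: action_profiles_def finite_PiE)

lemma support_subset: "support m i p \<subseteq> actions m i"
  by (auto simp: support_def)

lemma finite_support [simp]: "finite (support m i p)"
  by (rule finite_subset[OF support_subset finite_actions])

lemma mixed_strategies_nonneg: "p \<in> mixed_strategies m i \<Longrightarrow> j \<in> actions m i \<Longrightarrow> 0 \<le> p j"
  by (auto simp: mixed_strategies_def PiE_iff)

lemma mixed_strategies_sum: "p \<in> mixed_strategies m i \<Longrightarrow> (\<Sum>j\<in>actions m i. p j) = 1"
  by (simp add: mixed_strategies_def)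

lemma mixed_strategies_le_1:
  assumes "p \<in> mixed_strategies m i" "j \<in> actions m i"
  shows "p j \<le> 1"
  using member_le_sum[of j "actions m i" p] mixed_strategies_nonneg[OF assms(1)]
    mixed_strategies_sum[OF assms(1)] assms(2) by simp

lemma zero_outside_support:
  assumes "p \<in> mixed_strategies m i" "j \<in> actions m i" "j \<notin> support m i p"
  shows "p j = 0"
  using mixed_strategies_nonneg[OF assms(1,2)] assms by (auto simp: support_def)

lemma sum_support:
  assumes "p \<in> mixed_strategies m i"
  shows "(\<Sum>j\<in>actions m i. p j * f j) = (\<Sum>j\<in>support m i p. p j * f j)"
  using zero_outside_support[OF assms]
  by (intro sum.mono_neutral_right) (auto simp: support_def)

lemma sum_support_eq_1: "p \<in> mixed_strategies m i \<Longrightarrow> (\<Sum>j\<in>support m i p. p j) = 1"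
  using sum_support[of p m i "\<lambda>_. 1"] by (simp add: mixed_strategies_sum)

lemma support_nonempty: "p \<in> mixed_strategies m i \<Longrightarrow> support m i p \<noteq> {}"
  using sum_support_eq_1[of p m i] by fastforce

lemma pure_strategy_mixed: "j \<in> actions m i \<Longrightarrow> pure_strategy m i j \<in> mixed_strategies m i"
  by (auto simp: mixed_strategies_def pure_strategy_def of_bool_def sum.delta)

lemma mix_mixed:
  assumes "p \<in> mixed_strategies m i" "q \<in> mixed_strategies m i" "0 \<le> t" "t \<le> 1"
  shows "mix m i t p q \<in> mixed_strategies m i"
  using assms
  by (auto simp: mixed_strategies_def mix_def PiE_iff sum.distrib sum_distrib_left [symmetric])

lemma action_profile_in_actions: "a \<in> action_profiles n m \<Longrightarrow> i \<in> players n \<Longrightarrow> a i \<in> actions m i"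
  by (auto simp: action_profiles_def)

section \<open>Multilinearity of expected utility and its consequences\<close>

lemma prod_update:
  assumes "finite A" "s \<in> A"
  shows "(\<Prod>k\<in>A. (x(s := p)) k (a k)) = p (a s) * (\<Prod>k\<in>A - {s}. x k (a k))"
  using assms by (subst prod.remove[of _ s]) (auto intro!: prod.cong)

text \<open>Linearity in the strategy of one player: every product of probabilities contains exactly
  one factor of \<open>s\<close>, and \<open>p\<close> is a combination of point masses.\<close>

lemma expected_utility_decompose:
  assumes "s \<in> players n"
  shows "expected_utility n m U i (x(s := p)) =
    (\<Sum>j\<in>actions m s. p j * expected_utility n m U i (x(s := pure_strategy m s j)))"
proof -
  have "(\<Sum>j\<in>actions m s. p j * pure_strategy m s j (a s)) = p (a s)"
    if "a \<in> action_profiles n m" for a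
  proof -
    have "(\<Sum>j\<in>actions m s. p j * pure_strategy m s j (a s)) = (\<Sum>j\<in>actions m s. if a s = j then p j else 0)"
      using action_profile_in_actions[OF that assms] by (intro sum.cong) (auto simp: pure_strategy_def)
    then show ?thesis
      using action_profile_in_actions[OF that assms] by simp
  qed
  then have "expected_utility n m U i (x(s := p)) = (\<Sum>a\<in>action_profiles n m. U (i, a) *
      ((\<Sum>j\<in>actions m s. p j * pure_strategy m s j (a s)) * (\<Prod>k\<in>players n - {s}. x k (a k))))"
    unfolding expected_utility_def prod_update[OF finite_players assms] by simp
  also have "\<dots> = (\<Sum>a\<in>action_profiles n m. \<Sum>j\<in>actions m s.
      p j * (U (i, a) * (pure_strategy m s j (a s) * (\<Prod>k\<in>players n - {s}. x k (a k)))))"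
    by (simp add: sum_distrib_left sum_distrib_right mult_ac)
  also have "\<dots> = (\<Sum>j\<in>actions m s. p j * expected_utility n m U i (x(s := pure_strategy m s j)))"
    unfolding expected_utility_def prod_update[OF finite_players assms]
    by (subst sum.swap) (simp add: sum_distrib_left)
  finally show ?thesis .
qed

lemma expected_utility_mix:
  assumes "s \<in> players n"
  shows "expected_utility n m U i (x(s := mix m s t p q)) =
    (1 - t) * expected_utility n m U i (x(s := p)) + t * expected_utility n m U i (x(s := q))"
  unfolding expected_utility_decompose[OF assms, of _ _ _ _ "mix m s t p q"]
    expected_utility_decompose[OF assms, of _ _ _ _ p] expected_utility_decompose[OF assms, of _ _ _ _ q]
  by (simp add: mix_def sum.distrib sum_distrib_left distrib_right mult_ac cong: sum.cong)

lemma expected_utility_average: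
  assumes "s \<in> players n" "x s \<in> mixed_strategies m s"
  shows "expected_utility n m U i x =
    (\<Sum>j\<in>support m s (x s). x s j * expected_utility n m U i (x(s := pure_strategy m s j)))"
  using expected_utility_decompose[OF assms(1), of m U i x "x s"] sum_support[OF assms(2)] by simp

text \<open>This turns a failure of indifference into a beneficial action. If all values were at
  most the average \<open>v\<close>, the one different from \<open>v\<close> would lie below it and,
  having positive weight, pull the average below \<open>v\<close>.\<close>

lemma weighted_average_less:
  fixes w f :: "'a \<Rightarrow> real"
  assumes "finite A" "(\<Sum>j\<in>A. w j) = 1" "\<And>j. j \<in> A \<Longrightarrow> w j > 0"
    and "v = (\<Sum>j\<in>A. w j * f j)" "j0 \<in> A" "f j0 \<noteq> v"
  shows "\<exists>j\<in>A. f j > v"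
proof (rule ccontr)
  assume "\<not> ?thesis"
  then have le: "f j \<le> v" if "j \<in> A" for j
    using that by force
  with assms(5,6) have "f j0 < v"
    by force
  then have "(\<Sum>j\<in>A. w j * f j) < (\<Sum>j\<in>A. w j * v)"
    using assms(3,5) le by (intro sum_strict_mono_ex1[OF assms(1)]) (auto intro: mult_left_mono)
  then show False
    using assms(2,4) by (simp add: sum_distrib_right [symmetric])
qed

text \<open>The equilibrium utility is an average over the support with positive weights, so an
  action with a different utility would force some action above the average, a profitable
  deviation.\<close>

lemma nash_indifferent:
  assumes "nash_equilibrium n m U x" "i \<in> players n" "j \<in> support m i (x i)"
  shows "expected_utility n m U i (x(i := pure_strategy m i j)) = expected_utility n m U i x"
proof (rule ccontr)
  assume neq: "\<not> ?thesis"
  have x: "x i \<in> mixed_strategies m i"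
    using assms by (auto simp: nash_equilibrium_def mixed_profiles_def)
  have "\<exists>j\<in>support m i (x i). expected_utility n m U i (x(i := pure_strategy m i j)) > expected_utility n m U i x"
    using expected_utility_average[where s = i and x = x, OF assms(2) x, of U i] sum_support_eq_1[OF x] assms(3) neq
    by (intro weighted_average_less[where w = "x i"]) (auto simp: support_def)
  then obtain j' where "j' \<in> actions m i"
    "expected_utility n m U i (x(i := pure_strategy m i j')) > expected_utility n m U i x"
    by (auto simp: support_def)
  then show False
    using assms(1,2) pure_strategy_mixed[of j' m i] by (fastforce simp: nash_equilibrium_def)
qed

text \<open>The two expressions will be the gains of two players who both shift by \<open>t\<close>.
  Divided by \<open>t\<close> they tend to \<open>g\<close> and \<open>g'\<close> as
  \<open>t\<close> decreases to 0, so both are positive for a common small \<open>t\<close>.\<close>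

lemma small_quadratic_pos:
  fixes g h g' h' :: real
  assumes "g > 0" "g' > 0"
  obtains t where "0 < t" "t < 1" "t * (1 - t) * g + t ^ 2 * h > 0" "t * (1 - t) * g' + t ^ 2 * h' > 0"
proof -
  have "((\<lambda>t. (1 - t) * g + t * h) \<longlongrightarrow> (1 - 0) * g + 0 * h) (at_right 0)"
    by (intro tendsto_intros)
  then have 1: "eventually (\<lambda>t. (1 - t) * g + t * h > 0) (at_right 0)"
    using assms(1) by (auto intro: order_tendstoD)
  have "((\<lambda>t. (1 - t) * g' + t * h') \<longlongrightarrow> (1 - 0) * g' + 0 * h') (at_right 0)"
    by (intro tendsto_intros)
  then have 2: "eventually (\<lambda>t. (1 - t) * g' + t * h' > 0) (at_right 0)"
    using assms(2) by (auto intro: order_tendstoD)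
  have 3: "eventually (\<lambda>t::real. t \<in> {0<..<1}) (at_right 0)"
    by (intro eventually_at_right_real) simp
  have "eventually (\<lambda>t::real. (1 - t) * g + t * h > 0 \<and> (1 - t) * g' + t * h' > 0 \<and> t \<in> {0<..<1}) (at_right 0)"
    using 1 2 3 by eventually_elim auto
  then obtain t where t: "(1 - t) * g + t * h > 0" "(1 - t) * g' + t * h' > 0" "0 < t" "t < 1"
    using eventually_happens by fastforce
  show ?thesis
  proof (rule that[OF t(3,4)])
    show "t * (1 - t) * g + t ^ 2 * h > 0"
      using mult_pos_pos[OF t(3) t(1)] by (simp add: algebra_simps power2_eq_square)
    show "t * (1 - t) * g' + t ^ 2 * h' > 0"
      using mult_pos_pos[OF t(3) t(2)] by (simp add: algebra_simps power2_eq_square)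
  qed
qed

text \<open>Otherwise \<open>k\<close> has an action that benefits \<open>i\<close>, and \<open>i\<close> has one that benefits \<open>k\<close>; moving a little
  towards both of them costs the movers nothing to first order, by indifference.\<close>

lemma two_strong_indifferent:
  assumes strong: "strong_nash_equilibrium 2 n m U x"
    and ik: "i \<in> players n" "k \<in> players n" "i \<noteq> k"
  shows "(\<forall>l\<in>support m k (x k).
           expected_utility n m U i (x(k := pure_strategy m k l)) = expected_utility n m U i x) \<or>
         (\<forall>l\<in>support m i (x i).
           expected_utility n m U k (x(i := pure_strategy m i l)) = expected_utility n m U k x)"
proof (rule ccontr)
  assume neg: "\<not> ?thesis"
  let ?v = "expected_utility n m U"
  have nash: "nash_equilibrium n m U x"
    using strong by (simp add: strong_nash_equilibrium_def)
  then have x: "x \<in> mixed_profiles n m"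
    by (simp add: nash_equilibrium_def)
  then have xi: "x i \<in> mixed_strategies m i" and xk: "x k \<in> mixed_strategies m k"
    using ik by (auto simp: mixed_profiles_def)
  obtain l0 j0 where l0: "l0 \<in> support m k (x k)" "?v i (x(k := pure_strategy m k l0)) \<noteq> ?v i x"
    and j0: "j0 \<in> support m i (x i)" "?v k (x(i := pure_strategy m i j0)) \<noteq> ?v k x"
    using neg by blast
  have "\<exists>l\<in>support m k (x k). ?v i (x(k := pure_strategy m k l)) > ?v i x"
    using expected_utility_average[where s = k and x = x, OF ik(2) xk, of U i] sum_support_eq_1[OF xk] l0
    by (intro weighted_average_less[where w = "x k" and ?j0.0 = l0]) (auto simp: support_def)
  then obtain l where l: "l \<in> support m k (x k)" "?v i (x(k := pure_strategy m k l)) > ?v i x"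
    by blast
  have "\<exists>j\<in>support m i (x i). ?v k (x(i := pure_strategy m i j)) > ?v k x"
    using expected_utility_average[where s = i and x = x, OF ik(1) xi, of U k] sum_support_eq_1[OF xi] j0
    by (intro weighted_average_less[where w = "x i" and ?j0.0 = j0]) (auto simp: support_def)
  then obtain j where j: "j \<in> support m i (x i)" "?v k (x(i := pure_strategy m i j)) > ?v k x"
    by blast
  define p q where "p = pure_strategy m i j" and "q = pure_strategy m k l"
  have p: "p \<in> mixed_strategies m i" and q: "q \<in> mixed_strategies m k"
    unfolding p_def q_def using j(1) l(1) by (auto simp: support_def intro!: pure_strategy_mixed)
  \<comment> \<open>The second-order term: the gain of \<open>r\<close> when both players switch
    completely.\<close>
  define w where "w r = ?v r (x(i := p, k := q)) - ?v r x" for r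
  obtain t where t: "0 < t" "t < 1"
    "t * (1 - t) * (?v i (x(k := q)) - ?v i x) + t ^ 2 * w i > 0"
    "t * (1 - t) * (?v k (x(i := p)) - ?v k x) + t ^ 2 * w k > 0"
    using small_quadratic_pos[of "?v i (x(k := q)) - ?v i x" "?v k (x(i := p)) - ?v k x"] l(2) j(2)
    by (auto simp: p_def q_def)
  define y where "y = x(i := mix m i t (x i) p, k := mix m k t (x k) q)"
  have v: "?v r y = (1 - t) * ((1 - t) * ?v r x + t * ?v r (x(i := p))) +
      t * ((1 - t) * ?v r (x(k := q)) + t * ?v r (x(i := p, k := q)))" for r
  proof -
    have swap: "(x(i := s))(k := s') = (x(k := s'))(i := s)" for s s'
      using ik(3) by (simp add: fun_upd_twist)
    have "?v r y = (1 - t) * ?v r ((x(i := mix m i t (x i) p))(k := x k)) +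
        t * ?v r ((x(i := mix m i t (x i) p))(k := q))"
      unfolding y_def by (rule expected_utility_mix[OF ik(2)])
    also have "(x(i := mix m i t (x i) p))(k := x k) = x(i := mix m i t (x i) p)"
      using ik(3) by auto
    also have "?v r (x(i := mix m i t (x i) p)) = (1 - t) * ?v r x + t * ?v r (x(i := p))"
      by (subst expected_utility_mix[OF ik(1)]) simp
    also have "?v r ((x(i := mix m i t (x i) p))(k := q)) =
        (1 - t) * ?v r (x(k := q)) + t * ?v r (x(i := p, k := q))"
    proof -
      have "(x(k := q))(i := x i) = x(k := q)"
        using ik(3) by auto
      then show ?thesis
        unfolding swap by (subst expected_utility_mix[OF ik(1)]) simp
    qed
    finally show ?thesis .
  qed
  \<comment> \<open>By indifference the term of \<open>v\<close> in which only \<open>i\<close>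
    moves equals \<open>?v i x\<close>, so the first-order part of the gain of \<open>i\<close>
    comes from the move of \<open>k\<close> alone.\<close>
  have "?v i (x(i := p)) = ?v i x"
    unfolding p_def by (rule nash_indifferent[OF nash ik(1) j(1)])
  then have "?v i y - ?v i x = t * (1 - t) * (?v i (x(k := q)) - ?v i x) + t ^ 2 * w i"
    unfolding v w_def by (simp add: algebra_simps power2_eq_square)
  moreover have "?v k (x(k := q)) = ?v k x"
    unfolding q_def by (rule nash_indifferent[OF nash ik(2) l(1)])
  then have "?v k y - ?v k x = t * (1 - t) * (?v k (x(i := p)) - ?v k x) + t ^ 2 * w k"
    unfolding v w_def by (simp add: algebra_simps power2_eq_square)
  ultimately have better: "?v i y > ?v i x" "?v k y > ?v k x"
    using t by simp_all
  have "y \<in> mixed_profiles n m"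
    using x ik mix_mixed[OF xi p] mix_mixed[OF xk q] t
    unfolding mixed_profiles_def y_def by (intro PiE_I) (auto simp: PiE_iff extensional_def)
  then have "\<not> weakly_pareto_efficient n m U {i, k} x"
    using better unfolding weakly_pareto_efficient_def not_not by (intro bexI[of _ y]) (auto simp: y_def)
  moreover have "weakly_pareto_efficient n m U {i, k} x"
    using strong ik by (auto simp: strong_nash_equilibrium_def card_insert_if)
  ultimately show False
    by simp
qed

section \<open>Games with a prescribed support\<close>

text \<open>The bound \<open>\<delta>\<close> keeps the pivots of the linear systems uniformly away
  from 0. Every mixed profile with supports \<open>S\<close> satisfies it for some
  \<open>1 / real (Suc N)\<close>.\<close>

definition full_on :: "nat \<Rightarrow> (nat \<Rightarrow> nat) \<Rightarrow> (nat \<Rightarrow> nat set) \<Rightarrow> real \<Rightarrow> (nat \<Rightarrow> nat \<Rightarrow> real) set" where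
  "full_on n m S \<delta> =
     {x \<in> mixed_profiles n m. \<forall>r\<in>players n. support m r (x r) = S r \<and> (\<forall>j\<in>S r. \<delta> \<le> x r j)}"

text \<open>For fixed \<open>x\<close>, the expected utility of \<open>q\<close> after a deviation
  of \<open>s\<close> to \<open>j\<close> is linear in the game; this is its coefficient at the
  utility entry \<open>(q', b)\<close>.\<close>

definition deviation_coeff ::
    "nat \<Rightarrow> (nat \<Rightarrow> nat) \<Rightarrow> (nat \<Rightarrow> nat \<Rightarrow> real) \<Rightarrow> nat \<Rightarrow> nat \<Rightarrow> nat \<Rightarrow> nat \<times> (nat \<Rightarrow> nat) \<Rightarrow> real" where
  "deviation_coeff n m x q s j = (\<lambda>(q', b).
     if q' = q then \<Prod>r\<in>players n. (x(s := pure_strategy m s j)) r (b r) else 0)"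

lemma sum_deviation_coeff:
  assumes "q \<in> players n"
  shows "(\<Sum>z\<in>players n \<times> action_profiles n m. deviation_coeff n m x q s j z * U z) =
    expected_utility n m U q (x(s := pure_strategy m s j))"
proof -
  let ?g = "\<lambda>q' b. (\<Prod>r\<in>players n. (x(s := pure_strategy m s j)) r (b r)) * U (q', b)"
  have "(\<Sum>z\<in>players n \<times> action_profiles n m. deviation_coeff n m x q s j z * U z) =
      (\<Sum>q'\<in>players n. \<Sum>b\<in>action_profiles n m. if q' = q then ?g q' b else 0)"
    by (subst sum.cartesian_product)
      (auto simp: deviation_coeff_def simp del: fun_upd_apply intro!: sum.cong)
  also have "\<dots> = (\<Sum>q'\<in>players n. if q' = q then \<Sum>b\<in>action_profiles n m. ?g q' b else 0)"
    by (intro sum.cong) auto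
  also have "\<dots> = (\<Sum>b\<in>action_profiles n m. ?g q b)"
    using assms by simp
  finally show ?thesis
    by (simp add: expected_utility_def mult.commute del: fun_upd_apply)
qed

text \<open>The factor of \<open>s\<close> is 0 or 1, so the coefficient is independent of
  \<open>x s\<close> and vanishes wherever \<open>s\<close> does not play \<open>j\<close>. Pivots
  are chosen by this criterion.\<close>

lemma deviation_coeff_eq:
  assumes "s \<in> players n" "b \<in> action_profiles n m"
  shows "deviation_coeff n m x q s j (q', b) =
    (if q' = q \<and> b s = j then \<Prod>r\<in>players n - {s}. x r (b r) else 0)"
  using action_profile_in_actions[OF assms(2,1)]
  by (auto simp: deviation_coeff_def prod_update[OF finite_players assms(1)] pure_strategy_def simp del: fun_upd_apply)

lemma full_on_mixed: "x \<in> full_on n m S \<delta> \<Longrightarrow> r \<in> players n \<Longrightarrow> x r \<in> mixed_strategies m r"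
  by (auto simp: full_on_def mixed_profiles_def)

lemma full_on_support: "x \<in> full_on n m S \<delta> \<Longrightarrow> r \<in> players n \<Longrightarrow> support m r (x r) = S r"
  by (simp add: full_on_def)

text \<open>At most \<open>n\<close> factors remain, each at least \<open>\<delta>\<close>; as
  \<open>\<delta>\<close> is at most 1, the exponent may be raised to \<open>n\<close>.\<close>

lemma deviation_coeff_lower_bound:
  assumes "x \<in> full_on n m S \<delta>" "0 < \<delta>" "\<delta> \<le> 1" "s \<in> players n" "b \<in> action_profiles n m"
    and "\<And>r. r \<in> players n - {s} \<Longrightarrow> b r \<in> S r"
  shows "\<delta> ^ n \<le> deviation_coeff n m x q s (b s) (q, b)"
proof -
  have "card (players n - {s}) \<le> n"
    by (rule order_trans[OF card_mono[of "players n"]]) (auto simp: players_def)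
  then have "\<delta> ^ n \<le> \<delta> ^ card (players n - {s})"
    using assms(2,3) by (intro power_decreasing) auto
  also have "\<dots> = (\<Prod>r\<in>players n - {s}. \<delta>)"
    by simp
  also have "\<dots> \<le> (\<Prod>r\<in>players n - {s}. x r (b r))"
    using assms by (intro prod_mono) (auto simp: full_on_def)
  finally show ?thesis
    using assms(4,5) by (simp add: deviation_coeff_eq)
qed

text \<open>Replacing the factors one at a time changes the product by at most the sum of the single
  changes, since all factors lie between 0 and 1.\<close>

lemma deviation_coeff_Lipschitz:
  assumes x: "\<And>r. r \<in> players n \<Longrightarrow> x r \<in> mixed_strategies m r"
    and y: "\<And>r. r \<in> players n \<Longrightarrow> y r \<in> mixed_strategies m r"
    and near: "\<And>r j. r \<in> players n \<Longrightarrow> j \<in> actions m r \<Longrightarrow> \<bar>x r j - y r j\<bar> \<le> \<eta>"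
    and "0 \<le> \<eta>" "s \<in> players n" "b \<in> action_profiles n m"
  shows "\<bar>deviation_coeff n m x q s j (q', b) - deviation_coeff n m y q s j (q', b)\<bar> \<le> real n * \<eta>"
proof (cases "q' = q \<and> b s = j")
  case True
  have "\<bar>(\<Prod>r\<in>players n - {s}. x r (b r)) - (\<Prod>r\<in>players n - {s}. y r (b r))\<bar>
      \<le> (\<Sum>r\<in>players n - {s}. \<bar>x r (b r) - y r (b r)\<bar>)"
    using norm_prod_diff[of "players n - {s}" "\<lambda>r. x r (b r)" "\<lambda>r. y r (b r)"]
      mixed_strategies_le_1[OF x] mixed_strategies_le_1[OF y]
      mixed_strategies_nonneg[OF x] mixed_strategies_nonneg[OF y] action_profile_in_actions[OF assms(6)]
    by simp
  also have "\<dots> \<le> (\<Sum>r\<in>players n - {s}. \<eta>)"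
    using near action_profile_in_actions[OF assms(6)] by (intro sum_mono) auto
  also have "\<dots> \<le> (\<Sum>r\<in>players n. \<eta>)"
    using assms(4) by (intro sum_mono2) auto
  also have "\<dots> = real n * \<eta>"
    by (simp add: players_def)
  finally show ?thesis
    using True assms(5,6) by (simp add: deviation_coeff_eq)
qed (use assms in \<open>auto simp: deviation_coeff_eq\<close>)

text \<open>The probability of \<open>j0 r\<close> is determined by the others, so only
  \<open>D\<close> coordinates are free. One representative is taken from every grid cell that meets
  \<open>full_on\<close>: the net must satisfy the bound \<open>\<delta>\<close> itself, which
  arbitrary grid points may violate.\<close>

lemma full_on_net:
  assumes base: "\<And>r. r \<in> players n \<Longrightarrow> j0 r \<in> S r"
    and D: "D = card (SIGMA r:players n. S r - {j0 r})"
  shows "\<exists>Y\<subseteq>full_on n m S \<delta>. finite Y \<and> real (card Y) \<le> 2 ^ D * real (Suc N) ^ D \<and>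
    (\<forall>x\<in>full_on n m S \<delta>. \<exists>y\<in>Y. \<forall>r\<in>players n. \<forall>j\<in>actions m r.
       \<bar>x r j - y r j\<bar> \<le> (1 + (\<Sum>r\<in>players n. real (m r))) / real (Suc N))"
proof (cases "full_on n m S \<delta> = {}")
  case False
  let ?X = "full_on n m S \<delta>"
  let ?P = "SIGMA r:players n. S r - {j0 r}"
  define cell where "cell x = (\<lambda>(r, j)\<in>?P. nat \<lfloor>real (Suc N) * x r j\<rfloor>)" for x :: "nat \<Rightarrow> nat \<Rightarrow> real"
  define Y where "Y = inv_into ?X cell ` cell ` ?X"
  have S: "S r \<subseteq> actions m r" if "r \<in> players n" for r
    using False full_on_support[OF _ that] support_subset by blast
  have finP: "finite ?P"
    using S by (intro finite_SigmaI) (auto intro: finite_subset[OF _ finite_actions])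
  have range: "0 \<le> x r j \<and> x r j \<le> 1" if "x \<in> ?X" "r \<in> players n" "j \<in> actions m r" for x r j
    using mixed_strategies_nonneg mixed_strategies_le_1 full_on_mixed that by blast
  \<comment> \<open>A probability can equal 1, so each free coordinate has \<open>N + 2\<close>
    cells, at most \<open>2 * Suc N\<close>; hence the factor \<open>2 ^ D\<close>.\<close>
  have cells: "cell ` ?X \<subseteq> (?P \<rightarrow>\<^sub>E {..Suc N})"
  proof
    fix z assume "z \<in> cell ` ?X"
    then obtain x where x: "x \<in> ?X" "z = cell x"
      by blast
    have "nat \<lfloor>real (Suc N) * x r j\<rfloor> \<le> Suc N" if "(r, j) \<in> ?P" for r j
    proof -
      have "x r j \<le> 1"
        using range[OF x(1)] that S by auto
      then have "real (Suc N) * x r j \<le> real (Suc N)"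
        by (intro mult_left_le) auto
      then show ?thesis
        by linarith
    qed
    then show "z \<in> (?P \<rightarrow>\<^sub>E {..Suc N})"
      unfolding x(2) cell_def by (intro PiE_I) auto
  qed
  have "Y \<subseteq> ?X"
    by (auto simp: Y_def intro: inv_into_into)
  moreover have fin: "finite (cell ` ?X)"
    using finP by (intro finite_subset[OF cells] finite_PiE) auto
  then have "finite Y"
    by (simp add: Y_def)
  moreover have "real (card Y) \<le> 2 ^ D * real (Suc N) ^ D"
  proof -
    have "card Y \<le> card (cell ` ?X)"
      unfolding Y_def using fin by (rule card_image_le)
    also have "\<dots> \<le> card (?P \<rightarrow>\<^sub>E {..Suc N})"
      using cells finP by (intro card_mono) (auto intro: finite_PiE)
    also have "\<dots> = Suc (Suc N) ^ D"
      using finP by (simp add: card_PiE D)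
    also have "\<dots> \<le> (2 * Suc N) ^ D"
      by (intro power_mono) auto
    also have "\<dots> = 2 ^ D * Suc N ^ D"
      by (rule power_mult_distrib)
    finally have "real (card Y) \<le> real (2 ^ D * Suc N ^ D)"
      by (rule of_nat_mono)
    then show ?thesis
      by simp
  qed
  moreover have "\<exists>y\<in>Y. \<forall>r\<in>players n. \<forall>j\<in>actions m r.
       \<bar>x r j - y r j\<bar> \<le> (1 + (\<Sum>r\<in>players n. real (m r))) / real (Suc N)" if x: "x \<in> ?X" for x
  proof -
    define y where "y = inv_into ?X cell (cell x)"
    have y: "y \<in> ?X" "cell y = cell x" "y \<in> Y"
      using x by (auto simp: y_def Y_def inv_into_into f_inv_into_f)
    have free: "\<bar>x r j - y r j\<bar> \<le> 1 / real (Suc N)" if r: "r \<in> players n" "j \<in> S r - {j0 r}" for r j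
    proof -
      have "nat \<lfloor>real (Suc N) * x r j\<rfloor> = nat \<lfloor>real (Suc N) * y r j\<rfloor>"
        using fun_cong[OF y(2), of "(r, j)"] r by (simp add: cell_def)
      moreover have "0 \<le> real (Suc N) * x r j" "0 \<le> real (Suc N) * y r j"
        using range[OF x r(1), of j] range[OF y(1) r(1), of j] S[OF r(1)] r(2) by (auto intro!: mult_nonneg_nonneg)
      ultimately have "\<bar>real (Suc N) * x r j - real (Suc N) * y r j\<bar> \<le> 1"
        by linarith
      then have "real (Suc N) * \<bar>x r j - y r j\<bar> \<le> 1"
        by (simp add: right_diff_distrib [symmetric] abs_mult del: of_nat_Suc)
      then show ?thesis
        by (simp add: field_simps)
    qed
    have "\<bar>x r j - y r j\<bar> \<le> (1 + (\<Sum>r\<in>players n. real (m r))) / real (Suc N)"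
      if r: "r \<in> players n" "j \<in> actions m r" for r j
    proof -
      have le_sum: "real (m r) \<le> (\<Sum>r\<in>players n. real (m r))"
        using r by (intro member_le_sum) auto
      \<comment> \<open>A free probability errs by at most one cell width; that of
        \<open>j0 r\<close> errs by at most the sum of the free errors of \<open>r\<close>, which is
        where the numbers of actions enter; outside the support both vanish.\<close>
      consider "j \<in> S r - {j0 r}" | "j = j0 r" | "j \<notin> S r"
        by blast
      then show ?thesis
      proof cases
        case 1
        then have "\<bar>x r j - y r j\<bar> \<le> 1 / real (Suc N)"
          by (rule free[OF r(1)])
        also have "\<dots> \<le> (1 + (\<Sum>r\<in>players n. real (m r))) / real (Suc N)"
          by (intro divide_right_mono) (auto intro: sum_nonneg)
        finally show ?thesis .
      next
        case 2
        have finS: "finite (S r)"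
          using S[OF r(1)] by (rule finite_subset) simp
        have last: "z r (j0 r) = 1 - (\<Sum>j\<in>S r - {j0 r}. z r j)" if "z \<in> ?X" for z
          using sum_support_eq_1[OF full_on_mixed[OF that r(1)]] base[OF r(1)] finS
          by (simp add: full_on_support[OF that r(1)] sum.remove)
        have "x r j - y r j = (\<Sum>j\<in>S r - {j0 r}. y r j - x r j)"
          using last[OF x] last[OF y(1)] 2 by (simp add: sum_subtractf)
        also have "\<bar>\<dots>\<bar> \<le> (\<Sum>j\<in>S r - {j0 r}. 1 / real (Suc N))"
          using free[OF r(1)] by (intro order_trans[OF sum_abs] sum_mono) (auto simp: abs_minus_commute)
        also have "\<dots> = real (card (S r - {j0 r})) / real (Suc N)"
          by simp
        also have "\<dots> \<le> (1 + (\<Sum>r\<in>players n. real (m r))) / real (Suc N)"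
        proof (rule divide_right_mono)
          have "card (S r - {j0 r}) \<le> card (actions m r)"
            using S[OF r(1)] by (intro card_mono) auto
          then show "real (card (S r - {j0 r})) \<le> 1 + (\<Sum>r\<in>players n. real (m r))"
            using le_sum by (simp add: actions_def)
        qed simp
        finally show ?thesis .
      next
        case 3
        then have "x r j = 0" "y r j = 0"
          using zero_outside_support[OF full_on_mixed[OF x r(1)] r(2)]
            zero_outside_support[OF full_on_mixed[OF y(1) r(1)] r(2)]
          by (simp_all add: full_on_support[OF x r(1)] full_on_support[OF y(1) r(1)])
        then show ?thesis
          by (simp add: sum_nonneg)
      qed
    qed
    then show ?thesis
      using y(3) by blast
  qed
  ultimately show ?thesis
    by blast
qed auto

section \<open>Null sets of games with one indifference too many\<close>

definition indifferent_games ::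
    "nat \<Rightarrow> (nat \<Rightarrow> nat) \<Rightarrow> (nat \<Rightarrow> nat set) \<Rightarrow> real \<Rightarrow> nat \<Rightarrow> nat \<Rightarrow> game set" where
  "indifferent_games n m S \<delta> i k =
     {U \<in> players n \<times> action_profiles n m \<rightarrow>\<^sub>E UNIV. \<exists>x\<in>full_on n m S \<delta>.
        (\<forall>q\<in>players n. \<forall>j\<in>S q.
           expected_utility n m U q (x(q := pure_strategy m q j)) = expected_utility n m U q x) \<and>
        (\<forall>l\<in>S k. expected_utility n m U i (x(k := pure_strategy m k l)) = expected_utility n m U i x)}"

lemma sum_deviation_coeff_diff:
  assumes "q \<in> players n"
  shows "(\<Sum>z\<in>players n \<times> action_profiles n m.
      (deviation_coeff n m x q s j z - deviation_coeff n m x q t j' z) * U z) =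
    expected_utility n m U q (x(s := pure_strategy m s j)) -
    expected_utility n m U q (x(t := pure_strategy m t j'))"
  by (simp add: left_diff_distrib sum_subtractf sum_deviation_coeff[OF assms])

lemma two_le_card_other:
  assumes "card A \<ge> 2"
  shows "\<exists>j\<in>A. j \<noteq> j'"
proof (rule ccontr)
  assume "\<not> ?thesis"
  then have "card A \<le> card {j'}"
    by (intro card_mono) auto
  with assms show False
    by simp
qed

text \<open>When \<open>i\<close> alone mixes, all profiles in \<open>full_on\<close> agree except
  in the strategy of \<open>i\<close>, on which the coefficients of his own deviations do not
  depend. One fixed nontrivial linear equation for the game remains.\<close>

lemma indifferent_games_null_single:
  assumes "i \<in> players n" "card (S i) \<ge> 2" "\<And>r. r \<in> players n - {i} \<Longrightarrow> card (S r) \<le> 1"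
    and "0 < \<delta>" "\<delta> \<le> 1"
  shows "indifferent_games n m S \<delta> i i \<in> null_sets (game_space n m)"
proof (cases "full_on n m S \<delta> = {}")
  case True
  then have "indifferent_games n m S \<delta> i i = {}"
    by (simp add: indifferent_games_def)
  then show ?thesis
    by simp
next
  case False
  let ?I = "players n \<times> action_profiles n m"
  obtain x0 where x0: "x0 \<in> full_on n m S \<delta>"
    using False by blast
  have S: "S r \<subseteq> actions m r" "S r \<noteq> {}" if "r \<in> players n" for r
    using full_on_support[OF x0 that] support_subset[of m r "x0 r"]
      support_nonempty[OF full_on_mixed[OF x0 that]] by auto
  define j0 where "j0 r = (SOME j. j \<in> S r)" for r
  have j0: "j0 r \<in> S r" if "r \<in> players n" for r
    unfolding j0_def using S(2)[OF that] by (simp add: some_in_eq)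
  obtain j1 where j1: "j1 \<in> S i" "j1 \<noteq> j0 i"
    using two_le_card_other[OF assms(2)] by blast
  \<comment> \<open>The pivot: here \<open>i\<close> plays \<open>j1\<close>, so this entry occurs
    in the utility of \<open>j1\<close> but not in that of \<open>j0 i\<close>.\<close>
  define b where "b = (restrict j0 (players n))(i := j1)"
  define c where "c x p z = deviation_coeff n m x i i j1 z - deviation_coeff n m x i i (j0 i) z"
    for x and p z :: "nat \<times> (nat \<Rightarrow> nat)"
  have b: "b \<in> action_profiles n m"
    using j0 j1 S(1) assms(1) unfolding b_def action_profiles_def by (intro PiE_I) (auto simp: subset_iff)
  have "indifferent_games n m S \<delta> i i \<subseteq>
      {U \<in> ?I \<rightarrow>\<^sub>E UNIV. \<exists>x\<in>full_on n m S \<delta>. \<forall>p\<in>set [(i, b)]. (\<Sum>z\<in>?I. c x p z * U z) = 0}"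
  proof
    fix U assume "U \<in> indifferent_games n m S \<delta> i i"
    then obtain x where U: "U \<in> ?I \<rightarrow>\<^sub>E UNIV" and x: "x \<in> full_on n m S \<delta>"
      and eq: "\<And>j. j \<in> S i \<Longrightarrow>
        expected_utility n m U i (x(i := pure_strategy m i j)) = expected_utility n m U i x"
      unfolding indifferent_games_def by blast
    have "(\<Sum>z\<in>?I. c x (i, b) z * U z) = 0"
      using eq[OF j0[OF assms(1)]] eq[OF j1(1)] by (simp add: c_def sum_deviation_coeff_diff[OF assms(1)])
    then show "U \<in> {U \<in> ?I \<rightarrow>\<^sub>E UNIV. \<exists>x\<in>full_on n m S \<delta>. \<forall>p\<in>set [(i, b)]. (\<Sum>z\<in>?I. c x p z * U z) = 0}"
      using U x by auto
  qed
  moreover have "\<dots> \<in> null_sets (completion (\<Pi>\<^sub>M z\<in>?I. lborel))"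
  \<comment> \<open>The coefficients are constant in \<open>x\<close>, so a single profile is an
    exact net: dimension 0 and no error.\<close>
  proof (rule null_sets_union_solutions[where \<delta> = "\<delta> ^ n" and L = 0 and K = 1 and D = 0])
    show "\<delta> ^ n \<le> c x p p" if x: "x \<in> full_on n m S \<delta>" and p: "p \<in> set [(i, b)]" for x p
    proof -
      have "\<delta> ^ n \<le> deviation_coeff n m x i i (b i) (i, b)"
        using j0 x assms by (intro deviation_coeff_lower_bound[OF x] b) (auto simp: b_def)
      then show ?thesis
        using p j1 assms(1) by (simp add: c_def deviation_coeff_eq[OF assms(1) b]) (simp add: b_def)
    qed
    show "\<exists>Y\<subseteq>full_on n m S \<delta>. finite Y \<and> real (card Y) \<le> 1 * real (Suc N) ^ 0 \<and>
      (\<forall>x\<in>full_on n m S \<delta>. \<exists>y\<in>Y. \<forall>p\<in>set [(i, b)]. \<forall>z\<in>?I. \<bar>c x p z - c y p z\<bar> \<le> 0 / real (Suc N))" for N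
    proof (intro exI[of _ "{x0}"] conjI ballI bexI[of _ x0])
      fix x p z assume x: "x \<in> full_on n m S \<delta>" and z: "z \<in> ?I"
      have eq: "x r j = x0 r j" if r: "r \<in> players n - {i}" "j \<in> actions m r" for r j
      proof (cases "j \<in> S r")
        case True
        moreover have "card (S r) \<le> Suc 0" "finite (S r)"
          using assms(3)[OF r(1)] S(1)[of r] r(1) by (auto intro: finite_subset[OF _ finite_actions])
        ultimately have "S r = {j}"
          by (auto simp: card_le_Suc0_iff_eq)
        then show ?thesis
          using sum_support_eq_1[OF full_on_mixed[OF x, of r]] sum_support_eq_1[OF full_on_mixed[OF x0, of r]]
            full_on_support[OF x, of r] full_on_support[OF x0, of r] r by simp
      next
        case False
        then show ?thesis
          using zero_outside_support[OF full_on_mixed[OF x, of r] r(2)]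
            zero_outside_support[OF full_on_mixed[OF x0, of r] r(2)]
            full_on_support[OF x, of r] full_on_support[OF x0, of r] r by simp
      qed
      obtain q a where qa: "z = (q, a)" "a \<in> action_profiles n m"
        using z by auto
      have "(\<Prod>r\<in>players n - {i}. x r (a r)) = (\<Prod>r\<in>players n - {i}. x0 r (a r))"
        using eq action_profile_in_actions[OF qa(2)] by (intro prod.cong) auto
      then show "\<bar>c x p z - c x0 p z\<bar> \<le> 0 / real (Suc N)"
        by (simp add: c_def qa(1) deviation_coeff_eq[OF assms(1) qa(2)])
    qed (auto simp: x0)
  qed (use assms b in auto)
  ultimately show ?thesis
    unfolding game_space_def by (rule null_sets_completion_subset)
qed

text \<open>The unknown strategies are cut out by the indifference equations of the mixing players alone,
  and the extra equation for the utility of \<open>i\<close> is independent of these: each own equation has a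
  utility entry occurring in no other equation, and the extra one has an entry which occurs in
  only one own equation.\<close>

lemma indifferent_games_null_pair:
  assumes ik: "i \<in> players n" "k \<in> players n" "i \<noteq> k" and card: "card (S i) \<ge> 2" "card (S k) \<ge> 2"
    and "0 < \<delta>" "\<delta> \<le> 1"
  shows "indifferent_games n m S \<delta> i k \<in> null_sets (game_space n m)"
proof (cases "full_on n m S \<delta> = {}")
  case True
  then have "indifferent_games n m S \<delta> i k = {}"
    by (simp add: indifferent_games_def)
  then show ?thesis
    by simp
next
  case False
  let ?I = "players n \<times> action_profiles n m"
  obtain x0 where x0: "x0 \<in> full_on n m S \<delta>"
    using False by blast
  have S: "S r \<subseteq> actions m r" "S r \<noteq> {}" if "r \<in> players n" for r
    using full_on_support[OF x0 that] support_subset[of m r "x0 r"]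
      support_nonempty[OF full_on_mixed[OF x0 that]] by auto
  define j0 where "j0 r = (SOME j. j \<in> S r)" for r
  have j0: "j0 r \<in> S r" if "r \<in> players n" for r
    unfolding j0_def using S(2)[OF that] by (simp add: some_in_eq)
  obtain j1 where j1: "j1 \<in> S i" "j1 \<noteq> j0 i"
    using two_le_card_other[OF card(1)] by blast
  obtain l where l: "l \<in> S k" "l \<noteq> j0 k"
    using two_le_card_other[OF card(2)] by blast
  define a0 where "a0 = restrict j0 (players n)"
  \<comment> \<open>The pivot of the own equation for \<open>(q, j)\<close>: the utility of
    \<open>q\<close> at the reference profile with \<open>q\<close> switched to
    \<open>j\<close>.\<close>
  define own where "own = (\<lambda>(q :: nat, j). (q, a0(q := j)))"
  \<comment> \<open>Two switches: \<open>k\<close> plays \<open>l\<close>, so the entry occurs in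
    the deviation of \<open>k\<close> to \<open>l\<close>; \<open>i\<close> plays \<open>j1\<close>,
    so it is absent from the subtracted deviation of \<open>i\<close> to
    \<open>j0 i\<close>.\<close>
  define extra where "extra = (i, a0(i := j1, k := l))"
  define P where "P = (SIGMA r:players n. S r - {j0 r})"
  \<comment> \<open>Each equation is a difference of two utilities that both equal the utility of
    the profile: for \<open>own (q, j)\<close> the deviations of \<open>q\<close> to
    \<open>j\<close> and to \<open>j0 q\<close>, for \<open>extra\<close> those of \<open>k\<close>
    to \<open>l\<close> and of \<open>i\<close> to \<open>j0 i\<close>.\<close>
  define c where "c x p z =
      (if p = extra then deviation_coeff n m x i k l z
       else deviation_coeff n m x (fst p) (fst p) (snd p (fst p)) z) -
      deviation_coeff n m x (fst p) (fst p) (j0 (fst p)) z"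
    for x and p z :: "nat \<times> (nat \<Rightarrow> nat)"
  have finP: "finite P"
    unfolding P_def using S(1) by (intro finite_SigmaI) (auto intro: finite_subset[OF _ finite_actions])
  then obtain qs where qs: "set qs = P" "distinct qs"
    using finite_distinct_list by blast
  \<comment> \<open>\<open>extra\<close> must come last: its pivot occurs in the own equation of
    \<open>(i, j1)\<close>, whereas its equation contains none of the own pivots.\<close>
  define ps where "ps = map own qs @ [extra]"
  have inj: "inj_on own P"
    by (auto simp: inj_on_def own_def) (metis fun_upd_same)
  have own_neq: "own (q, j) \<noteq> extra" if "(q, j) \<in> P" for q j
  proof
    assume "own (q, j) = extra"
    then have eq: "q = i \<and> a0(q := j) = a0(i := j1, k := l)"
      unfolding own_def extra_def split_conv prod.inject .
    show False
      using fun_cong[OF conjunct2[OF eq], of k] conjunct1[OF eq] l ik by (simp add: a0_def)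
  qed
  have own_in: "a0(q := j) \<in> action_profiles n m" if "(q, j) \<in> P" for q j
    using that j0 S(1) unfolding a0_def action_profiles_def P_def by (intro PiE_I) (auto simp: subset_iff)
  have extra_in: "a0(i := j1, k := l) \<in> action_profiles n m"
    using ik j1 l j0 S(1) unfolding a0_def action_profiles_def by (intro PiE_I) (auto simp: subset_iff)
  have c_own: "c x (own (q, j)) z = deviation_coeff n m x q q j z - deviation_coeff n m x q q (j0 q) z"
    if "(q, j) \<in> P" for x q j z
    using own_neq[OF that] by (simp add: c_def) (simp add: own_def)
  have c_extra: "c x extra z = deviation_coeff n m x i k l z - deviation_coeff n m x i i (j0 i) z" for x z
    by (simp add: c_def) (simp add: extra_def)
  \<comment> \<open>A common shape for both kinds of equation, so that one Lipschitz estimate serves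
    all.\<close>
  have c_cases: "\<exists>q s t j j'. q \<in> players n \<and> s \<in> players n \<and> t \<in> players n \<and>
      (\<forall>x z. c x p z = deviation_coeff n m x q s j z - deviation_coeff n m x q t j' z)" if p: "p \<in> set ps" for p
  proof (cases "p = extra")
    case True
    then show ?thesis
      using ik c_extra by blast
  next
    case False
    then obtain q j where qj: "(q, j) \<in> P" "p = own (q, j)"
      using p qs by (auto simp: ps_def)
    then have "q \<in> players n"
      by (simp add: P_def)
    then show ?thesis
      using c_own[OF qj(1)] qj(2) by blast
  qed
  have "indifferent_games n m S \<delta> i k \<subseteq>
      {U \<in> ?I \<rightarrow>\<^sub>E UNIV. \<exists>x\<in>full_on n m S \<delta>. \<forall>p\<in>set ps. (\<Sum>z\<in>?I. c x p z * U z) = 0}"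
  proof
    fix U assume "U \<in> indifferent_games n m S \<delta> i k"
    then obtain x where U: "U \<in> ?I \<rightarrow>\<^sub>E UNIV" and x: "x \<in> full_on n m S \<delta>"
      and eqs: "\<And>q j. q \<in> players n \<Longrightarrow> j \<in> S q \<Longrightarrow>
        expected_utility n m U q (x(q := pure_strategy m q j)) = expected_utility n m U q x"
      "\<And>l. l \<in> S k \<Longrightarrow> expected_utility n m U i (x(k := pure_strategy m k l)) = expected_utility n m U i x"
      unfolding indifferent_games_def by blast
    have "(\<Sum>z\<in>?I. c x p z * U z) = 0" if p: "p \<in> set ps" for p
    proof (cases "p = extra")
      case True
      then show ?thesis
        using eqs(1)[OF ik(1) j0[OF ik(1)]] eqs(2)[OF l(1)] ik(1)
        by (simp add: c_extra sum_deviation_coeff_diff)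
    next
      case False
      then obtain q j where qj: "(q, j) \<in> P" "p = own (q, j)"
        using p qs by (auto simp: ps_def)
      then have "q \<in> players n" "j \<in> S q"
        by (auto simp: P_def)
      then show ?thesis
        using eqs(1)[of q] j0[of q] by (simp add: qj(2) c_own[OF qj(1)] sum_deviation_coeff_diff)
    qed
    then show "U \<in> {U \<in> ?I \<rightarrow>\<^sub>E UNIV. \<exists>x\<in>full_on n m S \<delta>. \<forall>p\<in>set ps. (\<Sum>z\<in>?I. c x p z * U z) = 0}"
      using U x by blast
  qed
  moreover have "\<dots> \<in> null_sets (completion (\<Pi>\<^sub>M z\<in>?I. lborel))"
  \<comment> \<open>\<open>D\<close> counts the free probabilities, one fewer than the equations.
    \<open>L\<close> is twice the Lipschitz constant \<open>n\<close>, as each coefficient is a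
    difference of two, times the numerator of the mesh in \<open>full_on_net\<close>.\<close>
  proof (rule null_sets_union_solutions[where \<delta> = "\<delta> ^ n" and K = "2 ^ card P" and D = "card P"
        and L = "2 * real n * (1 + (\<Sum>r\<in>players n. real (m r)))"])
    show "distinct ps"
      using qs inj own_neq by (auto simp: ps_def distinct_map)
    show "set ps \<subseteq> ?I"
      using qs ik extra_in own_in by (auto simp: ps_def own_def extra_def P_def)
    show "card P < length ps"
      using qs distinct_card[OF qs(2)] by (simp add: ps_def)
    show "sorted_wrt (\<lambda>p q. c x q p = 0) ps" for x
    proof -
      have own_own: "c x (own (q', j')) (own (q, j)) = 0"
        if "(q, j) \<in> P" "(q', j') \<in> P" "(q, j) \<noteq> (q', j')" for q j q' j'
      proof -
        have "q' \<in> players n"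
          using that by (auto simp: P_def)
        then show ?thesis
          using that unfolding c_own[OF that(2)]
          by (auto simp: own_def deviation_coeff_eq own_in P_def)
      qed
      have own_extra: "c x extra (own (q, j)) = 0" if "(q, j) \<in> P" for q j
        using that ik l unfolding c_extra
        by (auto simp: own_def deviation_coeff_eq own_in) (auto simp: P_def a0_def)
      \<comment> \<open>Own equations vanish at each other's pivots, so any order of
        \<open>qs\<close> will do.\<close>
      have "sorted_wrt (\<lambda>p q. c x (own q) (own p) = 0) qs"
        using qs own_own by (intro sorted_wrt_iff_nth_less[THEN iffD2])
          (metis nth_eq_iff_index_eq nth_mem less_trans nat_neq_iff prod.collapse)
      then show ?thesis
        using own_extra qs by (auto simp: ps_def sorted_wrt_append sorted_wrt_map)
    qed
    show "\<delta> ^ n \<le> c x p p" if x: "x \<in> full_on n m S \<delta>" and p: "p \<in> set ps" for x p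
    proof (cases "p = extra")
      case True
      have "\<delta> ^ n \<le> deviation_coeff n m x i k ((a0(i := j1, k := l)) k) (i, a0(i := j1, k := l))"
        using j0 j1 assms by (intro deviation_coeff_lower_bound[OF x] extra_in) (auto simp: a0_def)
      then show ?thesis
        using ik j1 unfolding True c_extra
        by (simp add: extra_def deviation_coeff_eq[OF ik(1) extra_in])
    next
      case False
      then obtain q j where qj: "(q, j) \<in> P" "p = own (q, j)"
        using p qs by (auto simp: ps_def)
      then have q: "q \<in> players n" "j \<noteq> j0 q"
        by (auto simp: P_def)
      have "\<delta> ^ n \<le> deviation_coeff n m x q q ((a0(q := j)) q) (q, a0(q := j))"
        using j0 q assms by (intro deviation_coeff_lower_bound[OF x] own_in[OF qj(1)]) (auto simp: a0_def)
      then show ?thesis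
        using q unfolding qj(2) c_own[OF qj(1)]
        by (simp add: own_def deviation_coeff_eq[OF q(1) own_in[OF qj(1)]])
    qed
    show "\<exists>Y\<subseteq>full_on n m S \<delta>. finite Y \<and> real (card Y) \<le> 2 ^ card P * real (Suc N) ^ card P \<and>
      (\<forall>x\<in>full_on n m S \<delta>. \<exists>y\<in>Y. \<forall>p\<in>set ps. \<forall>z\<in>?I.
         \<bar>c x p z - c y p z\<bar> \<le> 2 * real n * (1 + (\<Sum>r\<in>players n. real (m r))) / real (Suc N))" for N
    proof -
      let ?\<eta> = "(1 + (\<Sum>r\<in>players n. real (m r))) / real (Suc N)"
      obtain Y where Y: "Y \<subseteq> full_on n m S \<delta>" "finite Y" "real (card Y) \<le> 2 ^ card P * real (Suc N) ^ card P"
        and near: "\<And>x. x \<in> full_on n m S \<delta> \<Longrightarrow> \<exists>y\<in>Y. \<forall>r\<in>players n. \<forall>j\<in>actions m r. \<bar>x r j - y r j\<bar> \<le> ?\<eta>"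
        using full_on_net[of n j0 S "card P" m \<delta> N] j0 unfolding P_def by blast
      have "\<exists>y\<in>Y. \<forall>p\<in>set ps. \<forall>z\<in>?I. \<bar>c x p z - c y p z\<bar> \<le> 2 * real n * (1 + (\<Sum>r\<in>players n. real (m r))) / real (Suc N)"
        if x: "x \<in> full_on n m S \<delta>" for x
      proof -
        obtain y where y: "y \<in> Y" "\<And>r j. r \<in> players n \<Longrightarrow> j \<in> actions m r \<Longrightarrow> \<bar>x r j - y r j\<bar> \<le> ?\<eta>"
          using near[OF x] by blast
        have yX: "y \<in> full_on n m S \<delta>"
          using y(1) Y(1) by blast
        have \<eta>: "0 \<le> ?\<eta>"
          by (simp add: sum_nonneg)
        have Lip: "\<bar>deviation_coeff n m x q s j z - deviation_coeff n m y q s j z\<bar> \<le> real n * ?\<eta>"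
          if "s \<in> players n" "z \<in> ?I" for q s j z
          using deviation_coeff_Lipschitz[of n x m y ?\<eta> s "snd z" q j "fst z", OF full_on_mixed[OF x] full_on_mixed[OF yX] y(2) \<eta> that(1)] that(2)
          by auto
        have "\<bar>c x p z - c y p z\<bar> \<le> 2 * (real n * ?\<eta>)" if p: "p \<in> set ps" and z: "z \<in> ?I" for p z
        proof -
          obtain q s t j j' where "s \<in> players n" "t \<in> players n"
            and c: "\<And>x z. c x p z = deviation_coeff n m x q s j z - deviation_coeff n m x q t j' z"
            using c_cases[OF p] by blast
          then show ?thesis
            unfolding c using Lip[OF _ z, of s q j] Lip[OF _ z, of t q j'] by linarith
        qed
        then show ?thesis
          using y(1) by (intro bexI[of _ y]) (auto simp: mult.assoc)
      qed
      then show ?thesis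
        using Y by blast
    qed
    show "0 \<le> 2 * real n * (1 + (\<Sum>r\<in>players n. real (m r)))"
      by (simp add: sum_nonneg)
  qed (use assms in auto)
  ultimately show ?thesis
    unfolding game_space_def by (rule null_sets_completion_subset)
qed

text \<open>Describes the equilibrium by countable data: its supports, a lower bound for its
  positive probabilities, and the player who is also indifferent between the actions of
  \<open>k\<close>. The \<open>i\<close> obtained may differ from the given one.\<close>

lemma strong_nash_indifferent:
  assumes U: "U \<in> space (game_space n m)" and strong: "strong_nash_equilibrium 2 n m U x"
    and i: "i \<in> players n" "non_pure m i (x i)"
  obtains S N i k where "S \<in> players n \<rightarrow>\<^sub>E Pow (\<Union>r\<in>players n. actions m r)" "i \<in> players n" "k \<in> players n"
    "card (S i) \<ge> 2" "card (S k) \<ge> 2" "i = k \<Longrightarrow> (\<forall>r\<in>players n - {i}. card (S r) \<le> 1)"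
    "U \<in> indifferent_games n m S (1 / real (Suc N)) i k"
proof -
  define S where "S = (\<lambda>r\<in>players n. support m r (x r))"
  have nash: "nash_equilibrium n m U x" and x: "x \<in> mixed_profiles n m"
    using strong by (auto simp: strong_nash_equilibrium_def nash_equilibrium_def)
  have S: "S \<in> players n \<rightarrow>\<^sub>E Pow (\<Union>r\<in>players n. actions m r)"
    using support_subset by (fastforce simp: S_def)
  \<comment> \<open>The smallest positive probability; the inserted 1 keeps the set
    nonempty.\<close>
  define e where "e = Min (insert 1 (\<Union>r\<in>players n. x r ` S r))"
  have fin: "finite (\<Union>r\<in>players n. x r ` S r)"
    by (auto simp: S_def)
  then have "e > 0"
    by (auto simp: e_def S_def support_def)
  then obtain N where N: "1 / real (Suc N) < e"
    using reals_Archimedean by (auto simp: inverse_eq_divide)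
  have "1 / real (Suc N) \<le> x r j" if "r \<in> players n" "j \<in> S r" for r j
  proof -
    have "e \<le> x r j"
      unfolding e_def using fin that by (intro Min_le) auto
    then show ?thesis
      using N by simp
  qed
  then have full: "x \<in> full_on n m S (1 / real (Suc N))"
    using x by (auto simp: full_on_def S_def)
  have own: "expected_utility n m U q (x(q := pure_strategy m q j)) = expected_utility n m U q x"
    if "q \<in> players n" "j \<in> S q" for q j
    using nash_indifferent[OF nash that(1)] that by (simp add: S_def)
  have memI: "U \<in> indifferent_games n m S (1 / real (Suc N)) i' k'"
    if "\<And>l. l \<in> S k' \<Longrightarrow> expected_utility n m U i' (x(k' := pure_strategy m k' l)) = expected_utility n m U i' x"
    for i' k'
    using U full own that unfolding indifferent_games_def game_space_def
    by (intro CollectI conjI bexI[of _ x]) (auto simp: space_PiM)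
  have Si: "card (S i) \<ge> 2"
    using i by (simp add: S_def non_pure_def support_def)
  show ?thesis
  proof (cases "\<exists>k\<in>players n - {i}. card (S k) \<ge> 2")
    \<comment> \<open>A sole mixing player takes both roles, and the extra condition is his own
      indifference.\<close>
    case False
    then show ?thesis
      using that[OF S i(1) i(1) Si Si _ memI] own i(1) by (simp add: not_le less_Suc_eq_le numeral_2_eq_2)
  next
    case True
    then obtain k where k: "k \<in> players n" "k \<noteq> i" "card (S k) \<ge> 2"
      by blast
    \<comment> \<open>Which of the two mixing players takes the role of \<open>i\<close> depends on
      the alternative that holds.\<close>
    show ?thesis
      using two_strong_indifferent[OF strong i(1) k(1) k(2)[symmetric]]
    proof
      assume "\<forall>l\<in>support m k (x k). expected_utility n m U i (x(k := pure_strategy m k l)) = expected_utility n m U i x"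
      then show ?thesis
        using that[OF S i(1) k(1) Si k(3) _ memI] k by (simp add: S_def)
    next
      assume "\<forall>l\<in>support m i (x i). expected_utility n m U k (x(i := pure_strategy m i l)) = expected_utility n m U k x"
      then show ?thesis
        using that[OF S k(1) i(1) k(3) Si _ memI] k i by (simp add: S_def)
    qed
  qed
qed

theorem theorem4p1:
  fixes n :: nat and m :: "nat \<Rightarrow> nat"
  assumes "\<And>i. i \<in> players n \<Longrightarrow> m i \<ge> 1"
  shows "{U \<in> space (game_space n m).
            \<exists>x. strong_nash_equilibrium 2 n m U x \<and> (\<exists>i\<in>players n. non_pure m i (x i))}
         \<in> null_sets (game_space n m)"
proof -
  \<comment> \<open>Supports range over a finite set and \<open>N\<close> over the naturals, so the
    exceptional games are covered by countably many null sets; the last condition singles out the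
    case of one mixing player.\<close>
  let ?Q = "{(S, N :: nat, i, k). S \<in> players n \<rightarrow>\<^sub>E Pow (\<Union>r\<in>players n. actions m r) \<and>
      i \<in> players n \<and> k \<in> players n \<and> card (S i) \<ge> 2 \<and> card (S k) \<ge> 2 \<and>
      (i = k \<longrightarrow> (\<forall>r\<in>players n - {i}. card (S r) \<le> 1))}"
  let ?G = "\<lambda>(S, N :: nat, i, k). indifferent_games n m S (1 / real (Suc N)) i k"
  have "finite (players n \<rightarrow>\<^sub>E Pow (\<Union>r\<in>players n. actions m r))"
    by (intro finite_PiE) auto
  then have "countable ((players n \<rightarrow>\<^sub>E Pow (\<Union>r\<in>players n. actions m r)) \<times> (UNIV :: (nat \<times> nat \<times> nat) set))"
    by (intro countable_SIGMA) (auto intro: countable_finite countableI_type)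
  then have "countable ?Q"
    by (rule countable_subset[rotated]) auto
  moreover have "?G z \<in> null_sets (game_space n m)" if "z \<in> ?Q" for z
  proof -
    obtain S N i k where z: "z = (S, N, i, k)"
      by (cases z) auto
    show ?thesis
      using that indifferent_games_null_single[of i n S "1 / real (Suc N)" m]
        indifferent_games_null_pair[of i n k S "1 / real (Suc N)" m]
      by (cases "i = k") (simp_all add: z)
  qed
  ultimately have "(\<Union>z\<in>?Q. ?G z) \<in> null_sets (game_space n m)"
    by (intro null_sets_UN') auto
  moreover have "{U \<in> space (game_space n m).
      \<exists>x. strong_nash_equilibrium 2 n m U x \<and> (\<exists>i\<in>players n. non_pure m i (x i))} \<subseteq> (\<Union>z\<in>?Q. ?G z)"
  proof safe
    fix U x i
    assume "U \<in> space (game_space n m)" "strong_nash_equilibrium 2 n m U x" "i \<in> players n" "non_pure m i (x i)"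
    then obtain S N i k where "S \<in> players n \<rightarrow>\<^sub>E Pow (\<Union>r\<in>players n. actions m r)" "i \<in> players n" "k \<in> players n"
      "card (S i) \<ge> 2" "card (S k) \<ge> 2" "i = k \<Longrightarrow> (\<forall>r\<in>players n - {i}. card (S r) \<le> 1)"
      "U \<in> indifferent_games n m S (1 / real (Suc N)) i k"
      using strong_nash_indifferent by metis
    then show "U \<in> (\<Union>z\<in>?Q. ?G z)"
      by (intro UN_I[of "(S, N, i, k)"]) auto
  qed
  ultimately show ?thesis
    unfolding game_space_def by (rule null_sets_completion_subset[rotated])
qed

end
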